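(* Let $\mathcal{D}$ be a symmetric design with parameters $(n,k,\lambda)$ on the point set $[n]$. Then the blocks of $\mathcal{D}$ form a resolving set for the Johnson graph $J(n,k)$.
   Context: A 2-design with parameters $(n,k,\lambda)$, $n>k$, is a pair $([n],\mathcal{B})$ where $\mathcal{B}$ is a family of $k$-subsets of $[n]=\{1,\dots,n\}$ (blocks) such that every pair of distinct points lies in exactly $\lambda$ blocks; it is symmetric if $|\mathcal{B}|=n$. The Johnson graph $J(n,k)$ has as vertices the $k$-subsets of $[n]$, adjacent when their intersection has size $k-1$. A resolving set is a set $\mathcal{S}$ of vertices such that for all distinct vertices $U,W$ some $X\in\mathcal{S}$ has $d(U,X)\neq d(W,X)$. *)

theory Defs
  imports "Graph_Theory.Graph_Theory" "HOL-Library.Ramsey"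
begin

(* The blocks form a set, so there are no repeated blocks. *)
definition two_design :: "nat \<Rightarrow> nat \<Rightarrow> nat \<Rightarrow> nat set set \<Rightarrow> bool" where
  "two_design n k l \<B> \<longleftrightarrow>
     k < n \<and> \<B> \<subseteq> nsets {1..n} k \<and>
     (\<forall>x\<in>{1..n}. \<forall>y\<in>{1..n}. x \<noteq> y \<longrightarrow> card {b \<in> \<B>. x \<in> b \<and> y \<in> b} = l)"

definition symmetric_design :: "nat \<Rightarrow> nat \<Rightarrow> nat \<Rightarrow> nat set set \<Rightarrow> bool" where
  "symmetric_design n k l \<B> \<longleftrightarrow> two_design n k l \<B> \<and> card \<B> = n"

(* An undirected edge is a pair of opposite arcs, as in the locale graph.  The adjacency
   condition |A \<inter> B| = k - 1 avoids truncated subtraction; with k - 1 there would be a loop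
   for k = 0. *)
definition johnson_graph :: "nat \<Rightarrow> nat \<Rightarrow> (nat set, nat set \<times> nat set) pre_digraph" where
  "johnson_graph n k = with_proj
     \<lparr> pverts = nsets {1..n} k,
       parcs = {(A, B). A \<in> nsets {1..n} k \<and> B \<in> nsets {1..n} k \<and> card (A \<inter> B) + 1 = k} \<rparr>"

lemma graph_johnson_graph: "graph (johnson_graph n k)"
proof -
  define V where "V = nsets {1..n} k"
  define E where "E = {(A, B). A \<in> V \<and> B \<in> V \<and> card (A \<inter> B) + 1 = k}"
  have fin: "finite V"
    unfolding V_def by (simp add: finite_imp_finite_nsets)
  have sub: "E \<subseteq> V \<times> V"
    unfolding E_def by blast
  have fin': "finite E"
    using finite_subset[OF sub] fin by blast
  have sym: "sym E"
    unfolding E_def sym_def by (simp add: Int_commute)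
  have irr: "fst e \<noteq> snd e" if "e \<in> E" for e
    using that unfolding E_def V_def nsets_def by (cases e) auto
  have "pair_graph \<lparr> pverts = V, parcs = E \<rparr>"
  proof unfold_locales
    show "symmetric (with_proj \<lparr> pverts = V, parcs = E \<rparr>)"
      using sym by (simp add: symmetric_def)
  qed (use fin fin' sub irr in auto)
  then show ?thesis
    unfolding johnson_graph_def V_def E_def by (rule pair_graph.pair_graphD_graph)
qed

context wf_digraph
begin

(* Length of a shortest walk; infinite if there is none. *)
definition graph_dist :: "'a \<Rightarrow> 'a \<Rightarrow> ereal" where
  "graph_dist u v = \<mu> (\<lambda>_. 1) u v"

definition resolving_set :: "'a set \<Rightarrow> bool" where
  "resolving_set S \<longleftrightarrow>
     S \<subseteq> verts G \<and>
     (\<forall>u\<in>verts G. \<forall>w\<in>verts G. u \<noteq> w \<longrightarrow> (\<exists>x\<in>S. graph_dist u x \<noteq> graph_dist w x))"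

end

end

(* The distance from U to X in J(n,k) is |U - X|, so if no block separates U and W then the
   difference z of their indicator functions sums to 0 over every block.  Writing r_x for the number
   of blocks through x, double counting gives
     0 = \<Sum>_b (\<Sum>_{x \<in> b} z_x)^2 = \<Sum>_x (r_x - \<lambda>) z_x^2 + \<lambda> (\<Sum>_x z_x)^2,
   and r_x > \<lambda> forces z = 0. *)

theory Submission
  imports Defs
begin

section \<open>Distance in the Johnson graph\<close>

lemma wf_digraph_johnson_graph: "wf_digraph (johnson_graph n k)"
proof -
  interpret graph "johnson_graph n k" by (rule graph_johnson_graph)
  show ?thesis by (rule wf_digraph_axioms)
qed

lemma verts_johnson_graph: "verts (johnson_graph n k) = nsets {1..n} k"
  by (simp add: johnson_graph_def)

lemma tail_head_johnson_graph:
  "tail (johnson_graph n k) = fst" "head (johnson_graph n k) = snd"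
  by (simp_all add: johnson_graph_def)

lemma arcs_johnson_graph:
  "(A, B) \<in> arcs (johnson_graph n k) \<longleftrightarrow>
     A \<in> nsets {1..n} k \<and> B \<in> nsets {1..n} k \<and> card (A \<inter> B) + 1 = k"
  by (simp add: johnson_graph_def)

text \<open>An arc from U to V removes exactly one point of U, and U - X is contained in the union
  of U - V and V - X. So one step of a walk lowers the number of points outside X by at most
  one.\<close>

lemma card_Diff_le_length_awalk:
  assumes "pre_digraph.awalk (johnson_graph n k) U p X"
  shows "card (U - X) \<le> length p"
proof -
  interpret wf_digraph "johnson_graph n k" by (rule wf_digraph_johnson_graph)
  show ?thesis
    using assms
  proof (induction p arbitrary: U)
    case Nil
    then show ?case by (simp add: awalk_Nil_iff)
  next
    case (Cons e p)
    obtain A V where e: "e = (A, V)" by (cases e)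
    have UV: "(U, V) \<in> arcs (johnson_graph n k)" and walk: "awalk V p X"
      using Cons.prems by (auto simp: e awalk_Cons_iff tail_head_johnson_graph)
    have fin: "finite U" "finite V" and k: "card U = k" "card (U \<inter> V) + 1 = k"
      using UV by (auto simp: arcs_johnson_graph nsets_def)
    have "card (U - V) = 1"
      using k fin by (simp add: card_Diff_subset_Int)
    have "card (U - X) \<le> card ((U - V) \<union> (V - X))"
      using fin by (intro card_mono) auto
    also have "\<dots> \<le> card (U - V) + card (V - X)"
      by (rule card_Un_le)
    also have "\<dots> \<le> length (e # p)"
      using Cons.IH[OF walk] \<open>card (U - V) = 1\<close> by simp
    finally show ?case .
  qed
qed

text \<open>Exchanging a point of U - X for a point of X - U is one arc and brings U one point
  closer to X. Repeating this gives a walk that attains the lower bound.\<close>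

lemma ex_awalk_length_card_Diff:
  assumes "U \<in> nsets {1..n} k" "X \<in> nsets {1..n} k"
  shows "\<exists>p. pre_digraph.awalk (johnson_graph n k) U p X \<and> length p = card (U - X)"
proof -
  interpret wf_digraph "johnson_graph n k" by (rule wf_digraph_johnson_graph)
  have "\<exists>p. awalk U p X \<and> length p = m" if "card (U - X) = m" for m
    using assms(1) that
  proof (induction m arbitrary: U)
    case 0
    then have "U \<subseteq> X" "finite X" "card U = card X"
      using assms(2) by (auto simp: nsets_def)
    then have "U = X" by (simp add: card_subset_eq)
    then show ?case
      using assms(2) by (auto simp: awalk_Nil_iff verts_johnson_graph)
  next
    case (Suc m)
    have fin: "finite U" "finite X" and k: "card U = k" "card X = k"
      and sub: "U \<subseteq> {1..n}" "X \<subseteq> {1..n}"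
      using Suc.prems assms(2) by (auto simp: nsets_def)
    \<comment> \<open>Since U and X have the same size, a point b to bring in exists whenever there
      is a point a to take out.\<close>
    have "card (X - U) = card (U - X)"
      using fin k by (simp add: card_Diff_subset_Int Int_commute)
    then obtain a b where a: "a \<in> U" "a \<notin> X" and b: "b \<in> X" "b \<notin> U"
      using Suc.prems(2) by (metis DiffE card.empty ex_in_conv nat.distinct(1))
    define V where "V = insert b (U - {a})"
    have "0 < card U"
      using fin a by (auto simp: card_gt_0_iff)
    then have k1: "card (U - {a}) + 1 = k"
      using fin a k by simp
    have V: "V \<in> nsets {1..n} k"
      using fin k1 b sub by (auto simp: V_def nsets_def)
    have "U \<inter> V = U - {a}"
      using b by (auto simp: V_def)
    then have arc: "(U, V) \<in> arcs (johnson_graph n k)"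
      using V Suc.prems(1) k1 by (simp add: arcs_johnson_graph)
    have "V - X = (U - X) - {a}"
      using b by (auto simp: V_def)
    then have "card (V - X) = m"
      using a fin Suc.prems(2) by simp
    then obtain p where "awalk V p X" "length p = m"
      using Suc.IH[OF V] by blast
    then have "awalk U ((U, V) # p) X \<and> length ((U, V) # p) = Suc m"
      using arc by (simp add: awalk_Cons_iff tail_head_johnson_graph)
    then show ?case by blast
  qed
  then show ?thesis by blast
qed

text \<open>With unit costs \<open>\<mu>\<close> is the infimum of the walk lengths; the two
  previous lemmas bound it from below and attain the bound.\<close>

lemma graph_dist_johnson_graph:
  assumes "U \<in> nsets {1..n} k" "X \<in> nsets {1..n} k"
  shows "wf_digraph.graph_dist (johnson_graph n k) U X = ereal (card (U - X))"
proof -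
  interpret wf_digraph "johnson_graph n k" by (rule wf_digraph_johnson_graph)
  have cost: "awalk_cost (\<lambda>_. 1) p = length p" for p :: "(nat set \<times> nat set) list"
    by (induction p) auto
  obtain p where "awalk U p X" "length p = card (U - X)"
    using ex_awalk_length_card_Diff[OF assms] by blast
  then have "\<mu> (\<lambda>_. 1) U X \<le> ereal (card (U - X))"
    by (metis cost min_cost_le_walk_cost)
  moreover have "ereal (card (U - X)) \<le> \<mu> (\<lambda>_. 1) U X"
    unfolding \<mu>_def by (intro INF_greatest) (auto simp: cost intro: card_Diff_le_length_awalk)
  ultimately show ?thesis
    unfolding graph_dist_def by (rule antisym)
qed

section \<open>The quadratic form of a design\<close>

text \<open>For the point-block incidence matrix N this is the identity |N^T z|^2 = z^T (N N^T) z: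
  the entry of N N^T at (x, y) is the number of blocks through both points.\<close>

lemma sum_square_blocks:
  fixes z :: "'a \<Rightarrow> real"
  assumes "finite P" "finite \<B>" "\<And>b. b \<in> \<B> \<Longrightarrow> b \<subseteq> P"
  shows "(\<Sum>b\<in>\<B>. (\<Sum>x\<in>b. z x)\<^sup>2) =
    (\<Sum>x\<in>P. \<Sum>y\<in>P. z x * z y * card {b \<in> \<B>. x \<in> b \<and> y \<in> b})"
proof -
  \<comment> \<open>Indicators extend the sums from b to P, so that the index sets no longer depend
    on b and the sums can be exchanged.\<close>
  have "(\<Sum>x\<in>b. z x)\<^sup>2 = (\<Sum>x\<in>P. \<Sum>y\<in>P. z x * z y * of_bool (x \<in> b \<and> y \<in> b))"
    if "b \<in> \<B>" for b
  proof -
    have "(\<Sum>x\<in>b. z x) = (\<Sum>x\<in>P. z x * of_bool (x \<in> b))"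
      using assms(1) assms(3)[OF that]
      by (intro sum.mono_neutral_cong_left) auto
    then have "(\<Sum>x\<in>b. z x)\<^sup>2 =
        (\<Sum>x\<in>P. \<Sum>y\<in>P. (z x * of_bool (x \<in> b)) * (z y * of_bool (y \<in> b)))"
      by (simp only: power2_eq_square sum_product)
    also have "\<dots> = (\<Sum>x\<in>P. \<Sum>y\<in>P. z x * z y * of_bool (x \<in> b \<and> y \<in> b))"
      by (intro sum.cong refl) (simp add: of_bool_def)
    finally show ?thesis .
  qed
  then have "(\<Sum>b\<in>\<B>. (\<Sum>x\<in>b. z x)\<^sup>2) =
      (\<Sum>b\<in>\<B>. \<Sum>x\<in>P. \<Sum>y\<in>P. z x * z y * of_bool (x \<in> b \<and> y \<in> b))"
    by (rule sum.cong[OF refl])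
  also have "\<dots> = (\<Sum>x\<in>P. \<Sum>b\<in>\<B>. \<Sum>y\<in>P. z x * z y * of_bool (x \<in> b \<and> y \<in> b))"
    by (rule sum.swap)
  also have "\<dots> = (\<Sum>x\<in>P. \<Sum>y\<in>P. \<Sum>b\<in>\<B>. z x * z y * of_bool (x \<in> b \<and> y \<in> b))"
    by (rule sum.cong[OF refl]) (rule sum.swap)
  also have "\<dots> = (\<Sum>x\<in>P. \<Sum>y\<in>P. z x * z y * card {b \<in> \<B>. x \<in> b \<and> y \<in> b})"
  proof (intro sum.cong refl)
    fix x y
    have "(\<Sum>b\<in>\<B>. of_bool (x \<in> b \<and> y \<in> b)) = real (card {b \<in> \<B>. x \<in> b \<and> y \<in> b})"
      using assms(2) by (simp add: sum_of_bool_eq Int_def)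
    then show "(\<Sum>b\<in>\<B>. z x * z y * of_bool (x \<in> b \<and> y \<in> b)) =
        z x * z y * card {b \<in> \<B>. x \<in> b \<and> y \<in> b}"
      by (metis sum_distrib_left)
  qed
  finally show ?thesis .
qed

section \<open>Counting the blocks through a point\<close>

lemma two_design_block:
  assumes "two_design n k l \<B>" "b \<in> \<B>"
  shows "finite b" "b \<subseteq> {1..n}" "card b = k"
  using assms by (auto simp: two_design_def nsets_def)

lemma two_design_finite:
  assumes "two_design n k l \<B>"
  shows "finite \<B>"
  using assms finite_subset[OF _ finite_imp_finite_nsets[of "{1..n}" k]]
  by (auto simp: two_design_def)

text \<open>Double counting of the pairs (y, b) where y differs from x and the block b contains
  both. For k \<le> 1 the left side is 0, so the equation then says nothing about the number of
  blocks through x.\<close>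

lemma two_design_card_blocks_through:
  assumes "two_design n k l \<B>" "x \<in> {1..n}"
  shows "card {b \<in> \<B>. x \<in> b} * (k - 1) = l * (n - 1)"
proof -
  let ?T = "{b \<in> \<B>. x \<in> b}"
  have "(\<Sum>y\<in>{1..n} - {x}. card {b \<in> ?T. y \<in> b}) = (\<Sum>b\<in>?T. k - 1)"
  proof (rule sum_multicount_gen)
    show "\<forall>b\<in>?T. card {y \<in> {1..n} - {x}. y \<in> b} = k - 1"
    proof
      fix b assume b: "b \<in> ?T"
      then have "{y \<in> {1..n} - {x}. y \<in> b} = b - {x}"
        using two_design_block[OF assms(1)] by blast
      then show "card {y \<in> {1..n} - {x}. y \<in> b} = k - 1"
        using b two_design_block[OF assms(1)] by simp
    qed
  qed (use two_design_finite[OF assms(1)] in auto)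
  moreover have "(\<Sum>y\<in>{1..n} - {x}. card {b \<in> ?T. y \<in> b}) = (\<Sum>y\<in>{1..n} - {x}. l)"
    using assms by (intro sum.cong refl) (auto simp: two_design_def conj_assoc)
  ultimately show ?thesis
    using assms(2) by (simp add: mult.commute)
qed

text \<open>For k > 1 and \<open>l\<close> > 0 this follows from r (k - 1) = \<open>l\<close> (n -
  1) and k < n, where r is the number of blocks through x. The assumption that there are n blocks
  excludes \<open>l\<close> = 0 when k > 1, and settles k = 1 separately.\<close>

lemma symmetric_design_lambda_less:
  assumes "symmetric_design n k l \<B>" "0 < k" "x \<in> {1..n}"
  shows "l < card {b \<in> \<B>. x \<in> b}"
proof -
  have D: "two_design n k l \<B>" and "card \<B> = n" and "k < n"
    using assms(1) by (auto simp: symmetric_design_def two_design_def)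
  note B = two_design_block[OF D] and fin = two_design_finite[OF D]
  have r: "card {b \<in> \<B>. y \<in> b} * (k - 1) = l * (n - 1)" if "y \<in> {1..n}" for y
    using two_design_card_blocks_through[OF D that] .
  show ?thesis
  proof (cases "k = 1")
    case True
    then have l: "l = 0"
      using r[OF assms(3)] \<open>k < n\<close> by simp
    \<comment> \<open>There are n blocks among the n singletons, so every singleton is a
      block.\<close>
    have "\<B> = nsets {1..n} 1"
      using D \<open>card \<B> = n\<close> True
      by (intro card_subset_eq) (auto simp: two_design_def finite_imp_finite_nsets)
    then have "{x} \<in> {b \<in> \<B>. x \<in> b}"
      using assms(3) by (auto simp: nsets_def)
    then show ?thesis
      using l fin by (auto simp: card_gt_0_iff)
  next
    case False
    \<comment> \<open>Some block exists because n > 0, and it has a point y because k > 0. The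
      counting equation is applied at this y, not at x: its left side is positive there.\<close>
    have "l \<noteq> 0"
    proof
      assume "l = 0"
      obtain b where b: "b \<in> \<B>"
        using \<open>card \<B> = n\<close> \<open>k < n\<close> by fastforce
      then obtain y where y: "y \<in> b"
        using B(3)[OF b] \<open>0 < k\<close> by fastforce
      then have "card {b \<in> \<B>. y \<in> b} * (k - 1) = 0"
        using r[of y] B(2)[OF b] \<open>l = 0\<close> by auto
      then show False
        using b y fin False \<open>0 < k\<close> by auto
    qed
    show ?thesis
    proof (rule ccontr)
      assume "\<not> ?thesis"
      then have "l * (n - 1) \<le> l * (k - 1)"
        using r[OF assms(3)] mult_le_mono1[of "card {b \<in> \<B>. x \<in> b}" l "k - 1"] by simp
      then show False
        using \<open>l \<noteq> 0\<close> \<open>k < n\<close> \<open>0 < k\<close> by auto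
    qed
  qed
qed

text \<open>In matrix terms, N N^T = diag(r_x - \<open>l\<close>) + \<open>l\<close> J, with J the
  all-ones matrix, is positive definite, so N^T is injective.\<close>

lemma symmetric_design_sum_zero:
  fixes z :: "nat \<Rightarrow> real"
  assumes "symmetric_design n k l \<B>" "0 < k"
    and zero: "\<And>b. b \<in> \<B> \<Longrightarrow> (\<Sum>x\<in>b. z x) = 0"
    and x: "x \<in> {1..n}"
  shows "z x = 0"
proof -
  let ?P = "{1..n}" and ?r = "\<lambda>x. card {b \<in> \<B>. x \<in> b}"
  have D: "two_design n k l \<B>"
    using assms(1) by (simp add: symmetric_design_def)
  have row: "(\<Sum>y\<in>?P. z x * z y * card {b \<in> \<B>. x \<in> b \<and> y \<in> b}) =
      (real (?r x) - l) * (z x)\<^sup>2 + l * z x * (\<Sum>y\<in>?P. z y)" if "x \<in> ?P" for x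
  proof -
    \<comment> \<open>Every entry of the row is taken as \<open>l\<close>; the diagonal entry is
      really r_x, which the term at y = x corrects.\<close>
    have "(\<Sum>y\<in>?P. z x * z y * card {b \<in> \<B>. x \<in> b \<and> y \<in> b}) =
        (\<Sum>y\<in>?P. l * z x * z y + (if y = x then (real (?r x) - l) * (z x)\<^sup>2 else 0))"
    proof (intro sum.cong refl)
      fix y assume "y \<in> ?P"
      then show "z x * z y * card {b \<in> \<B>. x \<in> b \<and> y \<in> b} =
          l * z x * z y + (if y = x then (real (?r x) - l) * (z x)\<^sup>2 else 0)"
        using D that by (auto simp: two_design_def algebra_simps power2_eq_square)
    qed
    then show ?thesis
      using that by (simp add: sum.distrib sum_distrib_left)
  qed
  have "0 = (\<Sum>b\<in>\<B>. (\<Sum>x\<in>b. z x)\<^sup>2)"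
    using zero by simp
  also have "\<dots> = (\<Sum>x\<in>?P. (real (?r x) - l) * (z x)\<^sup>2 + l * z x * (\<Sum>y\<in>?P. z y))"
    using two_design_finite[OF D] two_design_block[OF D]
    by (subst sum_square_blocks[where P = ?P]) (simp_all add: row del: One_nat_def)
  also have "\<dots> = (\<Sum>x\<in>?P. (real (?r x) - l) * (z x)\<^sup>2) + l * (\<Sum>x\<in>?P. z x)\<^sup>2"
    by (simp only: sum.distrib power2_eq_square mult.assoc flip: sum_distrib_left sum_distrib_right)
  finally have eq: "(\<Sum>x\<in>?P. (real (?r x) - l) * (z x)\<^sup>2) + l * (\<Sum>x\<in>?P. z x)\<^sup>2 = 0"
    by simp
  have pos: "0 < real (?r x) - l" if "x \<in> ?P" for x
    using symmetric_design_lambda_less[OF assms(1,2) that] by simp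
  have nonneg: "0 \<le> (real (?r x) - l) * (z x)\<^sup>2" if "x \<in> ?P" for x
    using pos[OF that] by simp
  have "0 \<le> l * (\<Sum>x\<in>?P. z x)\<^sup>2"
    by simp
  moreover have "0 \<le> (\<Sum>x\<in>?P. (real (?r x) - l) * (z x)\<^sup>2)"
    by (rule sum_nonneg) (rule nonneg)
  ultimately have "(\<Sum>x\<in>?P. (real (?r x) - l) * (z x)\<^sup>2) = 0"
    using eq by linarith
  then have "(real (?r x) - l) * (z x)\<^sup>2 = 0"
    using x nonneg by (subst (asm) sum_nonneg_eq_0_iff) auto
  then show ?thesis
    using pos[OF x] by simp
qed

theorem theorem3p4:
  fixes n k l :: nat and \<B> :: "nat set set"
  assumes "symmetric_design n k l \<B>"
  shows "wf_digraph.resolving_set (johnson_graph n k) \<B>"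
proof -
  interpret wf_digraph "johnson_graph n k" by (rule wf_digraph_johnson_graph)
  have D: "two_design n k l \<B>"
    using assms by (simp add: symmetric_design_def)
  have sub: "\<B> \<subseteq> nsets {1..n} k"
    using D by (simp add: two_design_def)
  have "U = W"
    if U: "U \<in> nsets {1..n} k" and W: "W \<in> nsets {1..n} k"
      and dist: "\<forall>b\<in>\<B>. graph_dist U b = graph_dist W b" for U W
  proof (cases "k = 0")
    \<comment> \<open>Here the empty set is the only vertex. The case is split off because sums over
      empty blocks carry no information about z.\<close>
    case True
    then show ?thesis
      using U W by (auto simp: nsets_def)
  next
    case False
    have UW: "finite U" "finite W" "card U = k" "card W = k" "U \<subseteq> {1..n}" "W \<subseteq> {1..n}"
      using U W by (auto simp: nsets_def)
    \<comment> \<open>Equal distances to b mean |U - b| = |W - b|. As |U| = |W|, the intersections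
      with b also have equal size, and their difference is the sum over b of the difference of the
      indicators.\<close>
    have "(\<Sum>x\<in>b. of_bool (x \<in> U) - of_bool (x \<in> W) :: real) = 0" if "b \<in> \<B>" for b
    proof -
      have "card (U - b) = card (W - b)"
        using bspec[OF dist that] graph_dist_johnson_graph[OF U] graph_dist_johnson_graph[OF W]
          subsetD[OF sub that] by simp
      moreover have "card (U - b) + card (U \<inter> b) = card (W - b) + card (W \<inter> b)"
        using UW card_Int_Diff[of U b] card_Int_Diff[of W b] by simp
      ultimately have "card (b \<inter> U) = card (b \<inter> W)"
        by (simp add: Int_commute)
      then show ?thesis
        using two_design_block(1)[OF D that]
        by (simp add: sum_subtractf sum_of_bool_eq)
    qed
    then have "of_bool (x \<in> U) - of_bool (x \<in> W) = (0::real)" if "x \<in> {1..n}" for x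
      using symmetric_design_sum_zero[OF assms, of "\<lambda>x. of_bool (x \<in> U) - of_bool (x \<in> W)"] that False
      by simp
    then have "x \<in> U \<longleftrightarrow> x \<in> W" if "x \<in> {1..n}" for x
      using that by (fastforce simp: of_bool_def split: if_splits)
    then show ?thesis
      using UW by blast
  qed
  then show ?thesis
    using sub unfolding resolving_set_def verts_johnson_graph by blast
qed

end
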